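(* Let $a<b$ and let $f:[a,b]\rightarrow\mathbb{R}$ be continuous on $[a,b]$ and tendable at every point of $(a,b)$. Suppose that $f(a)\neq f(b)$. Then for every value $v$ strictly between $f(a)$ and $f(b)$ there exists a point $c_{v}\in f^{-1}(v)$ such that \[ \tau_{f}(c_{v})=\operatorname{sgn}\left[f(b)-f(a)\right]. \]
   Context: For a function $f$ and a point $x$, the one-sided detachments of $f$ at $x$ are $f_{\pm}^{;}(x)=\lim_{h\rightarrow0^{\pm}}\operatorname{sgn}\left[f(x+h)-f(x)\right]\in\{0,\pm1\}$, whenever these one-sided limits exist. The function $f$ is called tendable at $x$ if both one-sided detachments $f_{+}^{;}(x)$ and $f_{-}^{;}(x)$ exist, and in that case the tendency of $f$ at $x$ is $\tau_{f}(x)=\operatorname{sgn}\left[f_{+}^{;}(x)-f_{-}^{;}(x)\right]\in\{0,\pm1\}$. Here $\operatorname{sgn}$ is the sign function with $\operatorname{sgn}(0)=0$. *)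

theory Defs
  imports Complex_Main
begin

definition has_right_detachment :: "(real \<Rightarrow> real) \<Rightarrow> real \<Rightarrow> real \<Rightarrow> bool" where
  "has_right_detachment f x l \<longleftrightarrow> ((\<lambda>h. sgn (f (x + h) - f x)) \<longlongrightarrow> l) (at_right 0)"

definition has_left_detachment :: "(real \<Rightarrow> real) \<Rightarrow> real \<Rightarrow> real \<Rightarrow> bool" where
  "has_left_detachment f x l \<longleftrightarrow> ((\<lambda>h. sgn (f (x + h) - f x)) \<longlongrightarrow> l) (at_left 0)"

definition right_detachment :: "(real \<Rightarrow> real) \<Rightarrow> real \<Rightarrow> real" where
  "right_detachment f x = Lim (at_right 0) (\<lambda>h. sgn (f (x + h) - f x))"

definition left_detachment :: "(real \<Rightarrow> real) \<Rightarrow> real \<Rightarrow> real" where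
  "left_detachment f x = Lim (at_left 0) (\<lambda>h. sgn (f (x + h) - f x))"

definition tendable_at :: "(real \<Rightarrow> real) \<Rightarrow> real \<Rightarrow> bool" where
  "tendable_at f x \<longleftrightarrow> (\<exists>l. has_right_detachment f x l) \<and> (\<exists>l. has_left_detachment f x l)"

text \<open>Only meaningful where \<open>tendable_at f x\<close> holds; elsewhere \<open>Lim\<close> is unspecified.\<close>

definition tendency :: "(real \<Rightarrow> real) \<Rightarrow> real \<Rightarrow> real" where
  "tendency f x = sgn (right_detachment f x - left_detachment f x)"

end

theory Submission
  imports Defs
begin

text \<open>For \<open>f a < f b\<close> the point \<open>c = Sup {x \<in> {a..b}. f x < v}\<close> works: \<open>f \<ge> v\<close> to the
  right of \<open>c\<close>, so the right detachment is nonnegative, while \<open>f\<close> takes values below \<open>v = f c\<close>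
  arbitrarily close to the left of \<open>c\<close>, so the left detachment is \<open>-1\<close>. (The last point of the level
  set \<open>f = v\<close> does not work in general, as it may be a local minimum.) The
  case \<open>f a > f b\<close> follows by passing to \<open>-f\<close>.\<close>

lemma right_detachment_eqI:
  assumes "has_right_detachment f x l"
  shows "right_detachment f x = l"
  using assms unfolding has_right_detachment_def right_detachment_def
  by (intro tendsto_Lim) auto

lemma left_detachment_eqI:
  assumes "has_left_detachment f x l"
  shows "left_detachment f x = l"
  using assms unfolding has_left_detachment_def left_detachment_def
  by (intro tendsto_Lim) auto

lemma has_right_detachment_uminus:
  assumes "has_right_detachment f x l"
  shows "has_right_detachment (\<lambda>x. - f x) x (- l)"
proof -
  have "sgn (- f (x + h) - - f x) = - sgn (f (x + h) - f x)" for h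
    by (simp add: sgn_if)
  then show ?thesis
    using assms unfolding has_right_detachment_def by (simp add: tendsto_minus)
qed

lemma has_left_detachment_uminus:
  assumes "has_left_detachment f x l"
  shows "has_left_detachment (\<lambda>x. - f x) x (- l)"
proof -
  have "sgn (- f (x + h) - - f x) = - sgn (f (x + h) - f x)" for h
    by (simp add: sgn_if)
  then show ?thesis
    using assms unfolding has_left_detachment_def by (simp add: tendsto_minus)
qed

lemma tendable_at_uminus:
  assumes "tendable_at f x"
  shows "tendable_at (\<lambda>x. - f x) x"
  using assms has_right_detachment_uminus has_left_detachment_uminus
  unfolding tendable_at_def by blast

text \<open>Negation flips both detachments, and \<open>sgn\<close> is odd. Tendability lets each
  \<open>Lim\<close> be replaced by an actual limit.\<close>

lemma tendency_uminus:
  assumes "tendable_at f x"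
  shows "tendency (\<lambda>x. - f x) x = - tendency f x"
proof -
  obtain r l where r: "has_right_detachment f x r" and l: "has_left_detachment f x l"
    using assms unfolding tendable_at_def by blast
  show ?thesis
    unfolding tendency_def right_detachment_eqI[OF r] left_detachment_eqI[OF l]
      right_detachment_eqI[OF has_right_detachment_uminus[OF r]]
      left_detachment_eqI[OF has_left_detachment_uminus[OF l]]
    by (simp add: sgn_if)
qed

lemma exists_tendency_1:
  fixes f :: "real \<Rightarrow> real"
  assumes "a < b" and cont: "continuous_on {a..b} f"
    and tend: "\<And>x. x \<in> {a<..<b} \<Longrightarrow> tendable_at f x"
    and av: "f a < v" and vb: "v < f b"
  shows "\<exists>c\<in>{a<..<b}. f c = v \<and> tendency f c = 1"
proof -
  define S where "S = {x \<in> {a..b}. f x < v}"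
  define c where "c = Sup S"
  have aS: "a \<in> S" using assms by (simp add: S_def)
  have bdd: "bdd_above S" unfolding S_def by (auto intro: bdd_aboveI[of _ b])
  have ub: "x \<le> c" if "x \<in> S" for x
    unfolding c_def using that bdd by (rule cSup_upper)
  have cb: "c \<le> b" unfolding c_def by (rule cSup_least) (use aS S_def in auto)
  have ac: "a \<le> c" using ub[OF aS] .
  have close: "\<exists>x\<in>S. y < x" if "y < c" for y
    using that less_cSup_iff[OF _ bdd, of y] aS unfolding c_def by blast
  have "\<not> f c < v"
  proof
    assume fc: "f c < v"
    have "continuous_on {c..b} f"
      by (rule continuous_on_subset[OF cont]) (use ac in auto)
    \<comment> \<open>The midpoint value lies below \<open>v\<close>, which puts \<open>x\<close> in
      \<open>S\<close> and forces \<open>x = c\<close>, but above \<open>f c\<close>, which rules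
      this out.\<close>
    then obtain x where x: "c \<le> x" "x \<le> b" "f x = (f c + v) / 2"
      using IVT'[of f c "(f c + v) / 2" b] fc vb cb by fastforce
    have "x \<in> S" using x ac fc by (simp add: S_def field_simps)
    then have "x = c" using ub x by force
    then show False using x fc by (simp add: field_simps)
  qed
  moreover have "\<not> v < f c"
  proof
    assume fc: "v < f c"
    \<comment> \<open>The limit is taken within \<open>{a..b}\<close> because \<open>c\<close> is
      not yet known to be interior. It yields a neighbourhood of \<open>c\<close> free of points of
      \<open>S\<close>, against \<open>close\<close>.\<close>
    have "(f \<longlongrightarrow> f c) (at c within {a..b})"
      using cont ac cb unfolding continuous_on_def by simp
    then have "\<forall>\<^sub>F x in at c within {a..b}. v < f x"
      using fc by (rule order_tendstoD(1))
    then obtain d where d: "d > 0" "\<And>x. x \<in> {a..b} \<Longrightarrow> x \<noteq> c \<Longrightarrow> dist x c < d \<Longrightarrow> v < f x"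
      unfolding eventually_at by blast
    obtain x where x: "x \<in> S" "c - d < x" using close[of "c - d"] d by auto
    have "x \<noteq> c" using x fc by (auto simp: S_def)
    then have "v < f x"
      using d(2)[of x] x ub[OF x(1)] d(1) by (auto simp: S_def dist_real_def)
    then show False using x by (simp add: S_def)
  qed
  ultimately have fc: "f c = v" by simp
  \<comment> \<open>The value \<open>v\<close> differs from \<open>f a\<close> and
    \<open>f b\<close>, so \<open>c\<close> is neither endpoint.\<close>
  then have c: "c \<in> {a<..<b}" using ac cb av vb
    by (metis greaterThanLessThan_iff less_irrefl order_le_less)
  obtain r l where r: "has_right_detachment f c r" and l: "has_left_detachment f c l"
    using tend[OF c] unfolding tendable_at_def by blast
  have "\<forall>\<^sub>F h in at_right 0. 0 \<le> sgn (f (c + h) - f c)"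
    unfolding eventually_at_right_field
  \<comment> \<open>The bound \<open>b - c\<close> keeps \<open>c + h\<close> inside
    \<open>{a..b}\<close>, where lying outside \<open>S\<close> means
    \<open>f (c + h) \<ge> v\<close>.\<close>
  proof (intro exI[of _ "b - c"] conjI allI impI)
    fix h assume h: "0 < h" "h < b - c"
    have "c + h \<notin> S" using ub[of "c + h"] h by auto
    then show "0 \<le> sgn (f (c + h) - f c)" using h ac fc by (auto simp: S_def sgn_if)
  qed (use c in auto)
  then have "0 \<le> r"
    using r unfolding has_right_detachment_def by (intro tendsto_lowerbound) auto
  \<comment> \<open>Otherwise the sign would avoid \<open>-1\<close> on a whole left neighbourhood
    of \<open>0\<close>, yet \<open>close\<close> supplies a point of \<open>S\<close>
    there.\<close>
  moreover have "l = -1"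
  proof (rule ccontr)
    assume "l \<noteq> -1"
    then have "\<forall>\<^sub>F h in at_left 0. sgn (f (c + h) - f c) \<noteq> -1"
      using l unfolding has_left_detachment_def by (intro tendsto_imp_eventually_ne)
    then obtain d where d: "d < 0" "\<And>h. d < h \<Longrightarrow> h < 0 \<Longrightarrow> sgn (f (c + h) - f c) \<noteq> -1"
      unfolding eventually_at_left_field by blast
    obtain x where x: "x \<in> S" "c + d < x" using close[of "c + d"] d by auto
    have "x < c" using ub[OF x(1)] x fc by (cases "x = c") (auto simp: S_def)
    moreover have "sgn (f (c + (x - c)) - f c) = -1" using x fc by (auto simp: S_def)
    ultimately show False using d(2)[of "x - c"] x by auto
  qed
  \<comment> \<open>Whatever the exact value of \<open>r\<close>, the difference
    \<open>r - l\<close> is at least \<open>1\<close>.\<close>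
  ultimately have "tendency f c = 1"
    unfolding tendency_def right_detachment_eqI[OF r] left_detachment_eqI[OF l]
    by simp
  then show ?thesis using c fc by blast
qed

theorem theorem28:
  fixes f :: "real \<Rightarrow> real" and a b :: real
  assumes "a < b"
    and "continuous_on {a..b} f"
    and "\<And>x. x \<in> {a<..<b} \<Longrightarrow> tendable_at f x"
    and "f a \<noteq> f b"
  shows "\<forall>v. min (f a) (f b) < v \<and> v < max (f a) (f b) \<longrightarrow>
           (\<exists>c\<in>{a..b}. f c = v \<and> tendable_at f c \<and> tendency f c = sgn (f b - f a))"
proof (intro allI impI)
  fix v assume v: "min (f a) (f b) < v \<and> v < max (f a) (f b)"
  have "\<exists>c\<in>{a<..<b}. f c = v \<and> tendency f c = sgn (f b - f a)"
  proof (cases "f a < f b")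
    case True
    then show ?thesis
      using exists_tendency_1[OF assms(1-3), of v] v by auto
  next
    case False
    then have "f b < f a" using assms(4) by simp
    moreover have "\<exists>c\<in>{a<..<b}. - f c = - v \<and> tendency (\<lambda>x. - f x) c = 1"
      using assms(1-3) v calculation
      by (intro exists_tendency_1 continuous_on_minus tendable_at_uminus) auto
    \<comment> \<open>Undoing the negation gives tendency \<open>-1\<close>, which is the sign of
      \<open>f b - f a\<close> here.\<close>
    ultimately show ?thesis
      using tendency_uminus[OF assms(3)] by force
  qed
  then show "\<exists>c\<in>{a..b}. f c = v \<and> tendable_at f c \<and> tendency f c = sgn (f b - f a)"
    using assms(3) by (meson greaterThanLessThan_subseteq_atLeastAtMost_iff in_mono order_refl)
qed

end
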